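(* A quasigroup $(Q,\cdot)$ is A-nuclear if and only if it is a group isotope.
   Context: A quasigroup $(Q,\cdot)$ is a non-empty set $Q$ with a binary operation such that for all $a,b\in Q$ the equations $x\cdot a=b$ and $a\cdot y=b$ each have a unique solution. $\varepsilon$ is the identity permutation of $Q$. An autotopy of $(Q,\cdot)$ is a triple $(\alpha,\beta,\gamma)$ of permutations of $Q$ with $\alpha x\cdot\beta y=\gamma(x\cdot y)$ for all $x,y\in Q$; autotopies form a group under component-wise composition. The A-nuclei are the groups of autotopies: $N^A_l$ (left), those of the form $(\alpha,\varepsilon,\gamma)$; $N^A_r$ (right), those of the form $(\varepsilon,\beta,\gamma)$; $N^A_m$ (middle), those of the form $(\alpha,\beta,\varepsilon)$. The components of the A-nuclei are the groups of permutations ${}_1N^A_l$, ${}_3N^A_l$ (first, respectively third, components of elements of $N^A_l$), ${}_2N^A_r$, ${}_3N^A_r$ (second, third components of elements of $N^A_r$), ${}_1N^A_m$, ${}_2N^A_m$ (first, second components of elements of $N^A_m$). A quasigroup $(Q,\cdot)$ is A-nuclear if at least one of the groups ${}_1N^A_l$, ${}_3N^A_l$, ${}_2N^A_r$, ${}_3N^A_r$, ${}_1N^A_m$, ${}_2N^A_m$ acts transitively on $Q$. A quasigroup $(Q,\cdot)$ is a group isotope if there are a group $(Q,+)$ (not necessarily abelian) and permutations $\mu_1,\mu_2,\mu_3$ of $Q$ such that $x\cdot y=\mu_3^{-1}(\mu_1x+\mu_2y)$ for all $x,y\in Q$. *)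

theory Defs
  imports "HOL-Algebra.Group_Action"
begin

locale quasigroup =
  fixes Q :: "'a set" and f :: "'a \<Rightarrow> 'a \<Rightarrow> 'a" (infixl \<open>\<cdot>\<close> 70)
  assumes nonempty: "Q \<noteq> {}"
    and closed: "\<lbrakk>x \<in> Q; y \<in> Q\<rbrakk> \<Longrightarrow> x \<cdot> y \<in> Q"
    and left_div: "\<lbrakk>a \<in> Q; b \<in> Q\<rbrakk> \<Longrightarrow> \<exists>!x. x \<in> Q \<and> x \<cdot> a = b"
    and right_div: "\<lbrakk>a \<in> Q; b \<in> Q\<rbrakk> \<Longrightarrow> \<exists>!y. y \<in> Q \<and> a \<cdot> y = b"

text \<open>
  Permutations of \<open>Q\<close> are the elements of \<^const>\<open>BijGroup\<close> \<open>Q\<close>: they are extensional, hence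
  determined by their values on \<open>Q\<close>, and the identity permutation is its neutral element.
\<close>

definition autotopies :: "'a set \<Rightarrow> ('a \<Rightarrow> 'a \<Rightarrow> 'a) \<Rightarrow> (('a \<Rightarrow> 'a) \<times> ('a \<Rightarrow> 'a) \<times> ('a \<Rightarrow> 'a)) set"
  where "autotopies Q f = {(\<alpha>, \<beta>, \<gamma>). \<alpha> \<in> Bij Q \<and> \<beta> \<in> Bij Q \<and> \<gamma> \<in> Bij Q \<and>
    (\<forall>x\<in>Q. \<forall>y\<in>Q. f (\<alpha> x) (\<beta> y) = \<gamma> (f x y))}"

definition left_A_nucleus where
  "left_A_nucleus Q f = {(\<alpha>, \<beta>, \<gamma>) \<in> autotopies Q f. \<beta> = \<one>\<^bsub>BijGroup Q\<^esub>}"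

definition right_A_nucleus where
  "right_A_nucleus Q f = {(\<alpha>, \<beta>, \<gamma>) \<in> autotopies Q f. \<alpha> = \<one>\<^bsub>BijGroup Q\<^esub>}"

definition middle_A_nucleus where
  "middle_A_nucleus Q f = {(\<alpha>, \<beta>, \<gamma>) \<in> autotopies Q f. \<gamma> = \<one>\<^bsub>BijGroup Q\<^esub>}"

definition first_components :: "('a \<times> 'b \<times> 'c) set \<Rightarrow> 'a set"
  where "first_components N = (\<lambda>(\<alpha>, \<beta>, \<gamma>). \<alpha>) ` N"

definition second_components :: "('a \<times> 'b \<times> 'c) set \<Rightarrow> 'b set"
  where "second_components N = (\<lambda>(\<alpha>, \<beta>, \<gamma>). \<beta>) ` N"

definition third_components :: "('a \<times> 'b \<times> 'c) set \<Rightarrow> 'c set"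
  where "third_components N = (\<lambda>(\<alpha>, \<beta>, \<gamma>). \<gamma>) ` N"

text \<open>
  Besides transitivity, \<^const>\<open>transitive_action\<close> requires \<open>H\<close> to form a group under composition;
  for the components of the A-nuclei this follows from \<open>subgroup_A_nuclei\<close> and \<open>subgroup_components\<close> below.
\<close>

definition acts_transitively :: "('a \<Rightarrow> 'a) set \<Rightarrow> 'a set \<Rightarrow> bool"
  where "acts_transitively H Q \<longleftrightarrow> transitive_action (BijGroup Q\<lparr>carrier := H\<rparr>) Q (\<lambda>\<sigma>. \<sigma>)"

definition A_nuclear :: "'a set \<Rightarrow> ('a \<Rightarrow> 'a \<Rightarrow> 'a) \<Rightarrow> bool"
  where "A_nuclear Q f \<longleftrightarrow>
    acts_transitively (first_components (left_A_nucleus Q f)) Q \<or>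
    acts_transitively (third_components (left_A_nucleus Q f)) Q \<or>
    acts_transitively (second_components (right_A_nucleus Q f)) Q \<or>
    acts_transitively (third_components (right_A_nucleus Q f)) Q \<or>
    acts_transitively (first_components (middle_A_nucleus Q f)) Q \<or>
    acts_transitively (second_components (middle_A_nucleus Q f)) Q"

definition group_isotope :: "'a set \<Rightarrow> ('a \<Rightarrow> 'a \<Rightarrow> 'a) \<Rightarrow> bool"
  where "group_isotope Q f \<longleftrightarrow>
    (\<exists>G :: 'a monoid. group G \<and> carrier G = Q \<and>
      (\<exists>\<mu>\<^sub>1 \<in> Bij Q. \<exists>\<mu>\<^sub>2 \<in> Bij Q. \<exists>\<mu>\<^sub>3 \<in> Bij Q.
        \<forall>x\<in>Q. \<forall>y\<in>Q. f x y = inv_into Q \<mu>\<^sub>3 (\<mu>\<^sub>1 x \<otimes>\<^bsub>G\<^esub> \<mu>\<^sub>2 y)))"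

abbreviation (input) triple_group :: "'a set \<Rightarrow> (('a \<Rightarrow> 'a) \<times> ('a \<Rightarrow> 'a) \<times> ('a \<Rightarrow> 'a)) monoid"
  where "triple_group Q \<equiv> BijGroup Q \<times>\<times> (BijGroup Q \<times>\<times> BijGroup Q)"

lemma group_triple_group: "group (triple_group Q)"
  by (intro DirProd_group group_BijGroup)

lemma BijGroup_mult_apply:
  "\<lbrakk>\<sigma> \<in> Bij Q; \<tau> \<in> Bij Q; x \<in> Q\<rbrakk> \<Longrightarrow> (\<sigma> \<otimes>\<^bsub>BijGroup Q\<^esub> \<tau>) x = \<sigma> (\<tau> x)"
  by (simp add: BijGroup_def compose_def)

lemma Bij_apply_mem: "\<lbrakk>\<sigma> \<in> Bij Q; x \<in> Q\<rbrakk> \<Longrightarrow> \<sigma> x \<in> Q"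
  using Bij_imp_funcset by blast

lemma carrier_BijGroup: "carrier (BijGroup Q) = Bij Q"
  by (simp add: BijGroup_def)

lemma (in quasigroup) subgroup_autotopies: "subgroup (autotopies Q f) (triple_group Q)"
proof -
  interpret B: group "BijGroup Q" by (rule group_BijGroup)
  interpret T: group "triple_group Q" by (rule group_triple_group)
  have invB: "inv\<^bsub>BijGroup Q\<^esub> \<sigma> \<in> Bij Q" if "\<sigma> \<in> Bij Q" for \<sigma>
    using that B.inv_closed by (simp add: carrier_BijGroup)
  have inv1: "\<sigma> ((inv\<^bsub>BijGroup Q\<^esub> \<sigma>) x) = x" if "\<sigma> \<in> Bij Q" "x \<in> Q" for \<sigma> x
    using that by (simp add: inv_BijGroup Bij_def bij_betw_def f_inv_into_f)
  have inv2: "(inv\<^bsub>BijGroup Q\<^esub> \<sigma>) (\<sigma> x) = x" if "\<sigma> \<in> Bij Q" "x \<in> Q" for \<sigma> x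
    using that Bij_apply_mem[OF that] by (simp add: inv_BijGroup Bij_def bij_betw_def inv_into_f_f)
  show ?thesis
  proof (rule T.subgroupI)
    show "autotopies Q f \<subseteq> carrier (triple_group Q)"
      by (auto simp: autotopies_def carrier_BijGroup)
    have "(\<lambda>x\<in>Q. x, \<lambda>x\<in>Q. x, \<lambda>x\<in>Q. x) \<in> autotopies Q f"
      by (auto simp: autotopies_def id_Bij closed)
    then show "autotopies Q f \<noteq> {}" by blast
  next
    fix a assume "a \<in> autotopies Q f"
    then obtain \<alpha> \<beta> \<gamma> where a: "a = (\<alpha>, \<beta>, \<gamma>)"
      and B: "\<alpha> \<in> Bij Q" "\<beta> \<in> Bij Q" "\<gamma> \<in> Bij Q"
      and eq: "\<And>x y. x \<in> Q \<Longrightarrow> y \<in> Q \<Longrightarrow> \<alpha> x \<cdot> \<beta> y = \<gamma> (x \<cdot> y)"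
      by (auto simp: autotopies_def)
    have inva: "inv\<^bsub>triple_group Q\<^esub> a =
        (inv\<^bsub>BijGroup Q\<^esub> \<alpha>, inv\<^bsub>BijGroup Q\<^esub> \<beta>, inv\<^bsub>BijGroup Q\<^esub> \<gamma>)"
      using B by (simp add: a DirProd_group group_BijGroup carrier_BijGroup)
    have "(inv\<^bsub>BijGroup Q\<^esub> \<alpha>) x \<cdot> (inv\<^bsub>BijGroup Q\<^esub> \<beta>) y = (inv\<^bsub>BijGroup Q\<^esub> \<gamma>) (x \<cdot> y)"
      if "x \<in> Q" "y \<in> Q" for x y
    proof -
      have m: "(inv\<^bsub>BijGroup Q\<^esub> \<alpha>) x \<in> Q" "(inv\<^bsub>BijGroup Q\<^esub> \<beta>) y \<in> Q"
        using that B by (simp_all add: Bij_apply_mem[OF invB])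
      show ?thesis
        using eq[OF m] inv1[OF B(1) that(1)] inv1[OF B(2) that(2)] inv2[OF B(3) closed[OF m]]
        by simp
    qed
    then show "inv\<^bsub>triple_group Q\<^esub> a \<in> autotopies Q f"
      using B invB by (simp add: inva autotopies_def)
  next
    fix a b assume "a \<in> autotopies Q f" "b \<in> autotopies Q f"
    then show "a \<otimes>\<^bsub>triple_group Q\<^esub> b \<in> autotopies Q f"
      using B.m_closed[unfolded carrier_BijGroup]
      by (auto simp: autotopies_def BijGroup_mult_apply Bij_apply_mem closed)
  qed
qed

lemma (in quasigroup) subgroup_A_nuclei:
  "subgroup (left_A_nucleus Q f) (triple_group Q)"
  "subgroup (right_A_nucleus Q f) (triple_group Q)"
  "subgroup (middle_A_nucleus Q f) (triple_group Q)"
proof -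
  interpret B: group "BijGroup Q" by (rule group_BijGroup)
  interpret T: group "triple_group Q" by (rule group_triple_group)
  let ?C = "carrier (BijGroup Q)" and ?I = "{\<one>\<^bsub>BijGroup Q\<^esub>}"
  have 1: "subgroup (?C \<times> ?I \<times> ?C) (triple_group Q)"
    "subgroup (?I \<times> ?C \<times> ?C) (triple_group Q)"
    "subgroup (?C \<times> ?C \<times> ?I) (triple_group Q)"
    using DirProd_subgroups[OF group_BijGroup _ DirProd_group[OF group_BijGroup group_BijGroup]
        DirProd_subgroups[OF group_BijGroup _ group_BijGroup]]
      B.subgroup_self B.triv_subgroup
    by blast+
  have 2: "left_A_nucleus Q f = autotopies Q f \<inter> ?C \<times> ?I \<times> ?C"
    "right_A_nucleus Q f = autotopies Q f \<inter> ?I \<times> ?C \<times> ?C"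
    "middle_A_nucleus Q f = autotopies Q f \<inter> ?C \<times> ?C \<times> ?I"
    by (auto simp: left_A_nucleus_def right_A_nucleus_def middle_A_nucleus_def autotopies_def
        carrier_BijGroup)
  show
    "subgroup (left_A_nucleus Q f) (triple_group Q)"
    "subgroup (right_A_nucleus Q f) (triple_group Q)"
    "subgroup (middle_A_nucleus Q f) (triple_group Q)"
    unfolding 2 by (intro T.subgroups_Inter_pair subgroup_autotopies 1)+
qed

lemma subgroup_components:
  assumes "subgroup N (triple_group Q)"
  shows "subgroup (first_components N) (BijGroup Q)"
    and "subgroup (second_components N) (BijGroup Q)"
    and "subgroup (third_components N) (BijGroup Q)"
proof -
  have "group_hom (triple_group Q) (BijGroup Q) (\<lambda>(\<alpha>, \<beta>, \<gamma>). \<alpha>)"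
    "group_hom (triple_group Q) (BijGroup Q) (\<lambda>(\<alpha>, \<beta>, \<gamma>). \<beta>)"
    "group_hom (triple_group Q) (BijGroup Q) (\<lambda>(\<alpha>, \<beta>, \<gamma>). \<gamma>)"
    by (auto intro!: group_hom.intro group_triple_group group_BijGroup
        simp: group_hom_axioms_def hom_def)
  then show "subgroup (first_components N) (BijGroup Q)"
    "subgroup (second_components N) (BijGroup Q)"
    "subgroup (third_components N) (BijGroup Q)"
    unfolding first_components_def second_components_def third_components_def
    by (simp_all add: group_hom.subgroup_img_is_subgroup[OF _ assms])
qed

lemma acts_transitively_iff:
  assumes "subgroup H (BijGroup Q)"
  shows "acts_transitively H Q \<longleftrightarrow> (\<forall>x\<in>Q. \<forall>y\<in>Q. \<exists>\<sigma>\<in>H. \<sigma> x = y)"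
proof -
  have "group_hom (BijGroup Q\<lparr>carrier := H\<rparr>) (BijGroup Q) (\<lambda>\<sigma>. \<sigma>)"
    using subgroup.subgroup_is_group[OF assms group_BijGroup] subgroup.subset[OF assms]
    by (auto intro!: group_hom.intro group_BijGroup simp: group_hom_axioms_def hom_def)
  then show ?thesis
    by (auto simp: acts_transitively_def transitive_action_def group_action_def
        transitive_action_axioms_def)
qed

end

theory Submission
  imports Defs
begin

text \<open>
  If \<open>x \<cdot> y = \<mu>\<^sub>3\<^sup>-\<^sup>1 (\<mu>\<^sub>1 x + \<mu>\<^sub>2 y)\<close> for a group \<open>+\<close>, the left translations of the group,
  conjugated by \<open>\<mu>\<^sub>1\<close> and by \<open>\<mu>\<^sub>3\<close>, are the first and third components of autotopies in the left
  A-nucleus, and they act transitively.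

  Conversely, suppose that the first components \<open>\<alpha>\<close> of the left A-nucleus act transitively, and fix
  \<open>e \<in> Q\<close>. The equation \<open>\<alpha> x \<cdot> y = \<gamma> (x \<cdot> y)\<close> determines \<open>\<alpha>\<close> by its value at \<open>e\<close>
  (\<open>left_regular_unique\<close>), so there is exactly one such \<open>\<alpha>\<^sub>a\<close> with \<open>\<alpha>\<^sub>a e = a\<close>, and
  \<open>a + b = \<alpha>\<^sub>a b\<close> makes \<open>Q\<close> a group with neutral element \<open>e\<close>. Let \<open>\<rho> y\<close> be the solution \<open>z\<close> of
  \<open>z \<cdot> e = e \<cdot> y\<close>. Then
  \<open>x \<cdot> y = \<alpha>\<^sub>x e \<cdot> y = \<gamma>\<^sub>x (e \<cdot> y) = \<gamma>\<^sub>x (\<rho> y \<cdot> e) = \<alpha>\<^sub>x (\<rho> y) \<cdot> e = (x + \<rho> y) \<cdot> e\<close>,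
  so \<open>\<cdot>\<close> is isotopic to \<open>+\<close> (\<open>group_isotope_if_left_first\<close>). Transitivity of the third components
  implies that of the first. The right and middle A-nuclei of \<open>\<cdot>\<close> are, up to permuting components,
  the left A-nuclei of the opposite operation and of left division, and an operation is a group
  isotope as soon as its opposite, or its left division, is one.
\<close>

section \<open>Group isotopes and translations\<close>

lemma restrict_mem_Bij_iff: "restrict h Q \<in> Bij Q \<longleftrightarrow> bij_betw h Q Q"
  by (auto simp: Bij_def cong: bij_betw_cong)

lemma Bij_imp_bij_betw: "h \<in> Bij Q \<Longrightarrow> bij_betw h Q Q"
  by (simp add: Bij_def)

lemma (in group) bij_betw_inv: "bij_betw (\<lambda>x. inv x) (carrier G) (carrier G)"
  by (rule bij_betw_byWitness[where f' = "\<lambda>x. inv x"]) auto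

context quasigroup
begin

lemma right_cancel: "\<lbrakk>x \<in> Q; x' \<in> Q; a \<in> Q; x \<cdot> a = x' \<cdot> a\<rbrakk> \<Longrightarrow> x = x'"
  using left_div[of a "x' \<cdot> a"] closed by blast

lemma left_cancel: "\<lbrakk>y \<in> Q; y' \<in> Q; a \<in> Q; a \<cdot> y = a \<cdot> y'\<rbrakk> \<Longrightarrow> y = y'"
  using right_div[of a "a \<cdot> y'"] closed by blast

lemma bij_betw_left_translation:
  assumes "a \<in> Q"
  shows "bij_betw (\<lambda>y. a \<cdot> y) Q Q"
proof (rule bij_betw_imageI)
  show "inj_on (\<lambda>y. a \<cdot> y) Q"
    using left_cancel assms by (blast intro: inj_onI)
  show "(\<lambda>y. a \<cdot> y) ` Q = Q"
    using closed right_div[OF assms] assms by blast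
qed

lemma bij_betw_right_translation:
  assumes "a \<in> Q"
  shows "bij_betw (\<lambda>x. x \<cdot> a) Q Q"
proof (rule bij_betw_imageI)
  show "inj_on (\<lambda>x. x \<cdot> a) Q"
    using right_cancel assms by (blast intro: inj_onI)
  show "(\<lambda>x. x \<cdot> a) ` Q = Q"
    using closed left_div[OF assms] assms by blast
qed

text \<open>
  Being a group isotope, without the inverse permutation and without requiring extensionality.
\<close>

lemma group_isotope_iff:
  "group_isotope Q f \<longleftrightarrow> (\<exists>(G :: 'a monoid) \<mu>\<^sub>1 \<mu>\<^sub>2 \<mu>\<^sub>3. group G \<and> carrier G = Q \<and>
    bij_betw \<mu>\<^sub>1 Q Q \<and> bij_betw \<mu>\<^sub>2 Q Q \<and> bij_betw \<mu>\<^sub>3 Q Q \<and>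
    (\<forall>x\<in>Q. \<forall>y\<in>Q. \<mu>\<^sub>3 (x \<cdot> y) = \<mu>\<^sub>1 x \<otimes>\<^bsub>G\<^esub> \<mu>\<^sub>2 y))" (is "_ \<longleftrightarrow> ?R")
proof
  assume "group_isotope Q f"
  then obtain G :: "'a monoid" and \<mu>\<^sub>1 \<mu>\<^sub>2 \<mu>\<^sub>3 where G: "group G" "carrier G = Q"
    and \<mu>: "bij_betw \<mu>\<^sub>1 Q Q" "bij_betw \<mu>\<^sub>2 Q Q" "bij_betw \<mu>\<^sub>3 Q Q"
    and eq: "\<forall>x\<in>Q. \<forall>y\<in>Q. x \<cdot> y = inv_into Q \<mu>\<^sub>3 (\<mu>\<^sub>1 x \<otimes>\<^bsub>G\<^esub> \<mu>\<^sub>2 y)"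
    unfolding group_isotope_def by (blast intro: Bij_imp_bij_betw)
  have "\<mu>\<^sub>3 (x \<cdot> y) = \<mu>\<^sub>1 x \<otimes>\<^bsub>G\<^esub> \<mu>\<^sub>2 y" if "x \<in> Q" "y \<in> Q" for x y
  proof -
    have "\<mu>\<^sub>1 x \<otimes>\<^bsub>G\<^esub> \<mu>\<^sub>2 y \<in> Q"
      using that G \<mu> by (metis bij_betwE group.is_monoid monoid.m_closed)
    then show ?thesis
      using that eq \<mu>(3) by (simp add: bij_betw_inv_into_right)
  qed
  then show ?R using G \<mu> by blast
next
  assume ?R
  then obtain G :: "'a monoid" and \<mu>\<^sub>1 \<mu>\<^sub>2 \<mu>\<^sub>3 where G: "group G" "carrier G = Q"
    and \<mu>: "bij_betw \<mu>\<^sub>1 Q Q" "bij_betw \<mu>\<^sub>2 Q Q" "bij_betw \<mu>\<^sub>3 Q Q"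
    and eq: "\<And>x y. x \<in> Q \<Longrightarrow> y \<in> Q \<Longrightarrow> \<mu>\<^sub>3 (x \<cdot> y) = \<mu>\<^sub>1 x \<otimes>\<^bsub>G\<^esub> \<mu>\<^sub>2 y"
    by blast
  have inv: "inv_into Q (restrict \<mu>\<^sub>3 Q) (\<mu>\<^sub>3 z) = z" if "z \<in> Q" for z
    using that \<mu>(3) inv_into_f_f[of "restrict \<mu>\<^sub>3 Q" Q z] by (simp add: bij_betw_def)
  show "group_isotope Q f"
    unfolding group_isotope_def
  proof (intro exI[of _ G] conjI G bexI ballI)
    show "x \<cdot> y = inv_into Q (restrict \<mu>\<^sub>3 Q) (restrict \<mu>\<^sub>1 Q x \<otimes>\<^bsub>G\<^esub> restrict \<mu>\<^sub>2 Q y)"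
      if "x \<in> Q" "y \<in> Q" for x y
      using that inv closed eq[symmetric] by simp
  qed (use \<mu> in \<open>simp_all only: restrict_mem_Bij_iff\<close>)
qed

lemma left_A_nucleus_iff:
  "(\<alpha>, \<beta>, \<gamma>) \<in> left_A_nucleus Q f \<longleftrightarrow> \<alpha> \<in> Bij Q \<and> \<beta> = (\<lambda>x\<in>Q. x) \<and> \<gamma> \<in> Bij Q \<and>
    (\<forall>x\<in>Q. \<forall>y\<in>Q. \<alpha> x \<cdot> y = \<gamma> (x \<cdot> y))"
  by (auto simp: left_A_nucleus_def autotopies_def BijGroup_def id_Bij)

section \<open>A transitive left A-nucleus\<close>

lemma left_regular_unique:
  assumes "\<And>x. x \<in> Q \<Longrightarrow> \<alpha> x \<in> Q" "\<And>x y. \<lbrakk>x \<in> Q; y \<in> Q\<rbrakk> \<Longrightarrow> \<alpha> x \<cdot> y = \<gamma> (x \<cdot> y)"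
    and "\<And>x. x \<in> Q \<Longrightarrow> \<alpha>' x \<in> Q" "\<And>x y. \<lbrakk>x \<in> Q; y \<in> Q\<rbrakk> \<Longrightarrow> \<alpha>' x \<cdot> y = \<gamma>' (x \<cdot> y)"
    and "e \<in> Q" "\<alpha> e = \<alpha>' e" "x \<in> Q"
  shows "\<alpha> x = \<alpha>' x"
proof -
  obtain y where y: "y \<in> Q" "e \<cdot> y = x \<cdot> e"
    using right_div[of e "x \<cdot> e"] closed[of x e] assms(5,7) by blast
  have "\<alpha> x \<cdot> e = \<gamma> (e \<cdot> y)"
    using assms(2)[of x e] assms(5,7) y by simp
  also have "\<dots> = \<alpha>' e \<cdot> y"
    using assms(2)[of e y] assms(5,6) y by simp
  also have "\<dots> = \<alpha>' x \<cdot> e"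
    using assms(4)[of e y] assms(4)[of x e] assms(5,7) y by simp
  finally show ?thesis
    using right_cancel[of "\<alpha> x" "\<alpha>' x" e] assms(1,3,5,7) by simp
qed

lemma group_isotope_if_left_first:
  assumes "acts_transitively (first_components (left_A_nucleus Q f)) Q"
  shows "group_isotope Q f"
proof -
  obtain e where e: "e \<in> Q" using nonempty by blast
  define T where "T \<alpha> \<gamma> \<longleftrightarrow> \<alpha> \<in> Bij Q \<and> (\<forall>x\<in>Q. \<forall>y\<in>Q. \<alpha> x \<cdot> y = \<gamma> (x \<cdot> y))" for \<alpha> \<gamma>
  have "\<exists>\<alpha> \<gamma>. T \<alpha> \<gamma> \<and> \<alpha> e = a" if a: "a \<in> Q" for a
  proof -
    obtain \<alpha> where "\<alpha> \<in> first_components (left_A_nucleus Q f)" and \<alpha>: "\<alpha> e = a"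
      using assms e a acts_transitively_iff[OF subgroup_components(1)[OF subgroup_A_nuclei(1)]]
      by blast
    then obtain \<beta> \<gamma> where "(\<alpha>, \<beta>, \<gamma>) \<in> left_A_nucleus Q f"
      by (auto simp: first_components_def)
    then have "T \<alpha> \<gamma>" by (simp add: left_A_nucleus_iff T_def)
    with \<alpha> show ?thesis by blast
  qed
  then obtain A C where T: "\<And>a. a \<in> Q \<Longrightarrow> T (A a) (C a)" and Ae: "\<And>a. a \<in> Q \<Longrightarrow> A a e = a"
    by metis
  have bij: "bij_betw (A a) Q Q" if "a \<in> Q" for a
    using T[OF that] by (simp add: T_def Bij_imp_bij_betw)
  have AC: "A a x \<cdot> y = C a (x \<cdot> y)" if "a \<in> Q" "x \<in> Q" "y \<in> Q" for a x y
    using T[OF that(1)] that by (simp add: T_def)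
  have AQ: "A a x \<in> Q" if "a \<in> Q" "x \<in> Q" for a x
    using bij that by (meson bij_betwE)
  have A_inj: "x = y" if "a \<in> Q" "x \<in> Q" "y \<in> Q" "A a x = A a y" for a x y
    using bij[of a] that by (auto simp: bij_betw_def inj_on_def)
  have A_id: "A e x = x" if "x \<in> Q" for x
    by (rule left_regular_unique[of "A e" "C e" "\<lambda>x. x" "\<lambda>x. x" e x])
      (use that e AQ AC Ae in auto)
  have A_comp: "A (A a b) x = A a (A b x)" if "a \<in> Q" "b \<in> Q" "x \<in> Q" for a b x
    by (rule left_regular_unique[of "A (A a b)" "C (A a b)" "\<lambda>x. A a (A b x)" "\<lambda>x. C a (C b x)" e x])
      (use that e AQ AC Ae in auto)
  define G where "G = \<lparr>carrier = Q, mult = A, one = e\<rparr>"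
  have "group G"
  proof (rule groupI)
    fix b assume "b \<in> carrier G"
    then have b: "b \<in> Q" by (simp add: G_def)
    then have "e \<in> A b ` Q"
      using bij_betw_imp_surj_on[OF bij] e by simp
    then obtain b' where b': "b' \<in> Q" "A b b' = e"
      by auto
    \<comment> \<open>The right inverse is a left inverse, because \<open>A b\<close> is injective.\<close>
    have "A b (A b' b) = A b e"
      using A_comp[of b b' b] b b' A_id Ae by simp
    then have "A b' b = e"
      using A_inj AQ b b' e by blast
    then show "\<exists>y\<in>carrier G. y \<otimes>\<^bsub>G\<^esub> b = \<one>\<^bsub>G\<^esub>"
      using b' by (auto simp: G_def)
  qed (simp_all add: G_def e AQ A_id A_comp)
  define R where "R = inv_into Q (\<lambda>x. x \<cdot> e)"
  have R: "bij_betw R Q Q"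
    unfolding R_def by (intro bij_betw_inv_into bij_betw_right_translation e)
  have \<rho>: "bij_betw (\<lambda>y. R (e \<cdot> y)) Q Q"
    using bij_betw_trans[OF bij_betw_left_translation[OF e] R] by (simp add: comp_def)
  have eq: "R (x \<cdot> y) = x \<otimes>\<^bsub>G\<^esub> R (e \<cdot> y)" if "x \<in> Q" "y \<in> Q" for x y
  proof -
    define z where "z = R (e \<cdot> y)"
    have z: "z \<in> Q" "z \<cdot> e = e \<cdot> y"
      using that e closed R bij_betw_inv_into_right[OF bij_betw_right_translation[OF e]]
      by (auto simp: z_def R_def dest: bij_betwE)
    have "x \<cdot> y = A x z \<cdot> e"
      using AC[of x e y] AC[of x z e] that z e Ae by simp
    then have "R (x \<cdot> y) = A x z"
      using bij_betw_inv_into_left[OF bij_betw_right_translation[OF e]] AQ that z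
      by (simp add: R_def)
    then show ?thesis by (simp add: G_def z_def)
  qed
  show ?thesis
    unfolding group_isotope_iff
  proof (intro exI conjI ballI)
    show "group G" by fact
    show "carrier G = Q" by (simp add: G_def)
    show "bij_betw (\<lambda>x. x) Q Q" using bij_betw_id by (simp add: id_def)
  qed (fact \<rho> R eq)+
qed

lemma left_first_transitive_if_third:
  assumes "acts_transitively (third_components (left_A_nucleus Q f)) Q"
  shows "acts_transitively (first_components (left_A_nucleus Q f)) Q"
  unfolding acts_transitively_iff[OF subgroup_components(1)[OF subgroup_A_nuclei(1)]]
proof (intro ballI)
  fix x y assume xy: "x \<in> Q" "y \<in> Q"
  obtain \<gamma> where "\<gamma> \<in> third_components (left_A_nucleus Q f)" "\<gamma> (x \<cdot> x) = y \<cdot> x"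
    using assms xy acts_transitively_iff[OF subgroup_components(3)[OF subgroup_A_nuclei(1)]] closed
    by blast
  then obtain \<alpha> \<beta> where N: "(\<alpha>, \<beta>, \<gamma>) \<in> left_A_nucleus Q f" and \<gamma>: "\<gamma> (x \<cdot> x) = y \<cdot> x"
    by (auto simp: third_components_def)
  then have "\<alpha> x \<cdot> x = y \<cdot> x" "\<alpha> x \<in> Q"
    using xy by (auto simp: left_A_nucleus_iff Bij_apply_mem)
  then have "\<alpha> x = y"
    using right_cancel xy by blast
  moreover have "\<alpha> \<in> first_components (left_A_nucleus Q f)"
    using N by (force simp: first_components_def)
  ultimately show "\<exists>\<alpha>\<in>first_components (left_A_nucleus Q f). \<alpha> x = y" by blast
qed

corollary group_isotope_if_left:
  "acts_transitively (first_components (left_A_nucleus Q f)) Q \<or>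
    acts_transitively (third_components (left_A_nucleus Q f)) Q \<Longrightarrow> group_isotope Q f"
  using group_isotope_if_left_first left_first_transitive_if_third by blast

lemma left_first_transitive_if_group_isotope:
  assumes "group_isotope Q f"
  shows "acts_transitively (first_components (left_A_nucleus Q f)) Q"
  unfolding acts_transitively_iff[OF subgroup_components(1)[OF subgroup_A_nuclei(1)]]
proof (intro ballI)
  fix a b assume ab: "a \<in> Q" "b \<in> Q"
  obtain G :: "'a monoid" and \<mu>\<^sub>1 \<mu>\<^sub>2 \<mu>\<^sub>3 where "group G" and G: "carrier G = Q"
    and \<mu>: "bij_betw \<mu>\<^sub>1 Q Q" "bij_betw \<mu>\<^sub>2 Q Q" "bij_betw \<mu>\<^sub>3 Q Q"
    and eq: "\<And>x y. x \<in> Q \<Longrightarrow> y \<in> Q \<Longrightarrow> \<mu>\<^sub>3 (x \<cdot> y) = \<mu>\<^sub>1 x \<otimes>\<^bsub>G\<^esub> \<mu>\<^sub>2 y"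
    using assms unfolding group_isotope_iff by blast
  interpret G: group G by fact
  have \<mu>Q: "\<mu>\<^sub>1 x \<in> Q" "\<mu>\<^sub>2 x \<in> Q" "\<mu>\<^sub>3 x \<in> Q" if "x \<in> Q" for x
    using \<mu> that by (meson bij_betwE)+
  \<comment> \<open>Left translation by \<open>g\<close> takes \<open>\<mu>\<^sub>1 a\<close> to \<open>\<mu>\<^sub>1 b\<close>.\<close>
  define g where "g = \<mu>\<^sub>1 b \<otimes>\<^bsub>G\<^esub> inv\<^bsub>G\<^esub> \<mu>\<^sub>1 a"
  have g: "g \<in> Q" "g \<otimes>\<^bsub>G\<^esub> \<mu>\<^sub>1 a = \<mu>\<^sub>1 b"
    using ab \<mu>Q G.m_closed G.inv_closed by (simp_all add: g_def G.m_assoc flip: G)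
  have T: "bij_betw (\<lambda>x. g \<otimes>\<^bsub>G\<^esub> x) Q Q"
    using G.inj_on_multc G.surj_const_mult[of g] G.inj_on_cmult[of g] g by (simp add: bij_betw_def G)
  define conj where "conj \<mu> = (\<lambda>x\<in>Q. inv_into Q \<mu> (g \<otimes>\<^bsub>G\<^esub> \<mu> x))" for \<mu>
  have conj_Bij: "conj \<mu> \<in> Bij Q" if "bij_betw \<mu> Q Q" for \<mu>
    using bij_betw_trans[OF bij_betw_trans[OF that T] bij_betw_inv_into[OF that]]
    by (simp add: conj_def restrict_mem_Bij_iff comp_def)
  have conj_apply: "\<mu> (conj \<mu> x) = g \<otimes>\<^bsub>G\<^esub> \<mu> x" if "bij_betw \<mu> Q Q" "x \<in> Q" for \<mu> x
    using that bij_betwE[OF T] bij_betwE[OF that(1)]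
    by (simp add: conj_def bij_betw_inv_into_right)
  have "conj \<mu>\<^sub>1 x \<cdot> y = conj \<mu>\<^sub>3 (x \<cdot> y)" if "x \<in> Q" "y \<in> Q" for x y
  proof -
    have mem: "conj \<mu>\<^sub>1 x \<in> Q" "conj \<mu>\<^sub>3 (x \<cdot> y) \<in> Q"
      using that closed \<mu> conj_Bij by (simp_all add: Bij_apply_mem)
    have "\<mu>\<^sub>3 (conj \<mu>\<^sub>1 x \<cdot> y) = g \<otimes>\<^bsub>G\<^esub> (\<mu>\<^sub>1 x \<otimes>\<^bsub>G\<^esub> \<mu>\<^sub>2 y)"
      using that mem \<mu> g \<mu>Q by (simp add: eq conj_apply G.m_assoc G)
    also have "\<dots> = \<mu>\<^sub>3 (conj \<mu>\<^sub>3 (x \<cdot> y))"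
      using that closed \<mu> by (simp add: eq conj_apply)
    finally show ?thesis
      using \<mu>(3) mem that closed by (meson bij_betw_imp_inj_on inj_onD)
  qed
  then have "(conj \<mu>\<^sub>1, \<lambda>x\<in>Q. x, conj \<mu>\<^sub>3) \<in> left_A_nucleus Q f"
    using conj_Bij \<mu> by (simp add: left_A_nucleus_iff)
  then have "conj \<mu>\<^sub>1 \<in> first_components (left_A_nucleus Q f)"
    by (force simp: first_components_def)
  moreover have "conj \<mu>\<^sub>1 a = b"
    using ab g \<mu>(1) by (simp add: conj_def bij_betw_inv_into_left)
  ultimately show "\<exists>\<alpha>\<in>first_components (left_A_nucleus Q f). \<alpha> a = b" by blast
qed

section \<open>The opposite quasigroup and left division\<close>

lemma quasigroup_opposite: "quasigroup Q (\<lambda>x y. y \<cdot> x)"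
  using nonempty closed left_div right_div by unfold_locales auto

lemma right_A_nucleus_opposite:
  "right_A_nucleus Q f = (\<lambda>(\<alpha>, \<beta>, \<gamma>). (\<beta>, \<alpha>, \<gamma>)) ` left_A_nucleus Q (\<lambda>x y. y \<cdot> x)"
  by (force simp: right_A_nucleus_def left_A_nucleus_def autotopies_def)

lemma right_components_opposite:
  "second_components (right_A_nucleus Q f) = first_components (left_A_nucleus Q (\<lambda>x y. y \<cdot> x))"
  "third_components (right_A_nucleus Q f) = third_components (left_A_nucleus Q (\<lambda>x y. y \<cdot> x))"
  unfolding right_A_nucleus_opposite
  by (simp_all add: first_components_def second_components_def third_components_def image_image
      case_prod_beta)

text \<open>Inversion turns the isotopism of the opposite operation into one of the operation itself.\<close>

lemma group_isotope_if_opposite: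
  assumes "group_isotope Q (\<lambda>x y. y \<cdot> x)"
  shows "group_isotope Q f"
proof -
  interpret op: quasigroup Q "\<lambda>x y. y \<cdot> x" by (rule quasigroup_opposite)
  obtain G :: "'a monoid" and \<mu>\<^sub>1 \<mu>\<^sub>2 \<mu>\<^sub>3 where "group G" and G: "carrier G = Q"
    and \<mu>: "bij_betw \<mu>\<^sub>1 Q Q" "bij_betw \<mu>\<^sub>2 Q Q" "bij_betw \<mu>\<^sub>3 Q Q"
    and eq: "\<And>x y. x \<in> Q \<Longrightarrow> y \<in> Q \<Longrightarrow> \<mu>\<^sub>3 (y \<cdot> x) = \<mu>\<^sub>1 x \<otimes>\<^bsub>G\<^esub> \<mu>\<^sub>2 y"
    using assms unfolding op.group_isotope_iff by blast
  interpret G: group G by fact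
  have I: "bij_betw (\<lambda>x. inv\<^bsub>G\<^esub> x) Q Q"
    using G.bij_betw_inv by (simp add: G)
  have "bij_betw (\<lambda>x. inv\<^bsub>G\<^esub> \<mu> x) Q Q" if "bij_betw \<mu> Q Q" for \<mu>
    using bij_betw_trans[OF that I] by (simp add: comp_def)
  moreover have "inv\<^bsub>G\<^esub> \<mu>\<^sub>3 (x \<cdot> y) = inv\<^bsub>G\<^esub> \<mu>\<^sub>2 x \<otimes>\<^bsub>G\<^esub> inv\<^bsub>G\<^esub> \<mu>\<^sub>1 y" if "x \<in> Q" "y \<in> Q" for x y
    using that eq G.inv_mult_group bij_betwE[OF \<mu>(1)] bij_betwE[OF \<mu>(2)] by (simp add: G)
  ultimately show ?thesis
    unfolding group_isotope_iff using \<open>group G\<close> G \<mu> by blast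
qed

text \<open>
  \<open>left_quotient x z\<close> is the unique \<open>y\<close> in \<open>Q\<close> with \<open>x \<cdot> y = z\<close>; it is unspecified unless \<open>x\<close> and
  \<open>z\<close> are in \<open>Q\<close>.
\<close>

definition left_quotient :: "'a \<Rightarrow> 'a \<Rightarrow> 'a"
  where "left_quotient x z = (THE y. y \<in> Q \<and> x \<cdot> y = z)"

lemma left_quotient_mem: "\<lbrakk>x \<in> Q; z \<in> Q\<rbrakk> \<Longrightarrow> left_quotient x z \<in> Q"
  and mult_left_quotient: "\<lbrakk>x \<in> Q; z \<in> Q\<rbrakk> \<Longrightarrow> x \<cdot> left_quotient x z = z"
  using theI'[OF right_div] unfolding left_quotient_def by blast+

lemma left_quotient_eq_iff:
  "\<lbrakk>x \<in> Q; y \<in> Q; z \<in> Q\<rbrakk> \<Longrightarrow> left_quotient x z = y \<longleftrightarrow> x \<cdot> y = z"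
  using left_quotient_mem mult_left_quotient left_cancel by blast

lemma quasigroup_left_quotient: "quasigroup Q left_quotient"
proof
  show "\<exists>!x. x \<in> Q \<and> left_quotient x a = b" if "a \<in> Q" "b \<in> Q" for a b
    using left_div[OF that(2,1)] that by (simp add: left_quotient_eq_iff cong: conj_cong)
  show "\<exists>!y. y \<in> Q \<and> left_quotient a y = b" if "a \<in> Q" "b \<in> Q" for a b
    by (intro ex1I[of _ "a \<cdot> b"]) (use that closed in \<open>auto simp: left_quotient_eq_iff mult_left_quotient\<close>)
qed (simp_all add: nonempty left_quotient_mem)

lemma autotopies_left_quotient_iff:
  "(\<alpha>, \<gamma>, \<beta>) \<in> autotopies Q left_quotient \<longleftrightarrow> (\<alpha>, \<beta>, \<gamma>) \<in> autotopies Q f"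
proof (cases "\<alpha> \<in> Bij Q \<and> \<beta> \<in> Bij Q \<and> \<gamma> \<in> Bij Q")
  case True
  then have mem: "\<And>x. x \<in> Q \<Longrightarrow> \<alpha> x \<in> Q" "\<And>x. x \<in> Q \<Longrightarrow> \<beta> x \<in> Q" "\<And>x. x \<in> Q \<Longrightarrow> \<gamma> x \<in> Q"
    by (simp_all add: Bij_apply_mem)
  have "(\<forall>x\<in>Q. \<forall>z\<in>Q. left_quotient (\<alpha> x) (\<gamma> z) = \<beta> (left_quotient x z)) \<longleftrightarrow>
      (\<forall>x\<in>Q. \<forall>z\<in>Q. \<alpha> x \<cdot> \<beta> (left_quotient x z) = \<gamma> z)"
    using mem left_quotient_mem left_quotient_eq_iff by simp
  also have "\<dots> \<longleftrightarrow> (\<forall>x\<in>Q. \<forall>y\<in>Q. \<alpha> x \<cdot> \<beta> y = \<gamma> (x \<cdot> y))"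
    (is "?L \<longleftrightarrow> ?R")
  proof
    assume L: ?L
    show ?R
    proof (intro ballI)
      fix x y assume xy: "x \<in> Q" "y \<in> Q"
      have "left_quotient x (x \<cdot> y) = y"
        using xy closed by (simp add: left_quotient_eq_iff)
      then show "\<alpha> x \<cdot> \<beta> y = \<gamma> (x \<cdot> y)"
        using L xy closed by metis
    qed
  qed (simp add: left_quotient_mem mult_left_quotient)
  finally show ?thesis
    using True by (simp add: autotopies_def)
qed (auto simp: autotopies_def)

lemma middle_A_nucleus_left_quotient:
  "middle_A_nucleus Q f = (\<lambda>(\<alpha>, \<gamma>, \<beta>). (\<alpha>, \<beta>, \<gamma>)) ` left_A_nucleus Q left_quotient"
  by (force simp: middle_A_nucleus_def left_A_nucleus_def autotopies_left_quotient_iff)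

lemma middle_components_left_quotient:
  "first_components (middle_A_nucleus Q f) = first_components (left_A_nucleus Q left_quotient)"
  "second_components (middle_A_nucleus Q f) = third_components (left_A_nucleus Q left_quotient)"
  unfolding middle_A_nucleus_left_quotient
  by (simp_all add: first_components_def second_components_def third_components_def image_image
      case_prod_beta)

text \<open>
  From \<open>\<mu>\<^sub>3 y = \<mu>\<^sub>1 x + \<mu>\<^sub>2 (x \<cdot> y)\<close> one gets \<open>\<mu>\<^sub>2 (x \<cdot> y) = - \<mu>\<^sub>1 x + \<mu>\<^sub>3 y\<close>.
\<close>

lemma group_isotope_if_left_quotient:
  assumes "group_isotope Q left_quotient"
  shows "group_isotope Q f"
proof -
  interpret lq: quasigroup Q left_quotient by (rule quasigroup_left_quotient)
  obtain G :: "'a monoid" and \<mu>\<^sub>1 \<mu>\<^sub>2 \<mu>\<^sub>3 where "group G" and G: "carrier G = Q"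
    and \<mu>: "bij_betw \<mu>\<^sub>1 Q Q" "bij_betw \<mu>\<^sub>2 Q Q" "bij_betw \<mu>\<^sub>3 Q Q"
    and eq: "\<And>x z. x \<in> Q \<Longrightarrow> z \<in> Q \<Longrightarrow> \<mu>\<^sub>3 (left_quotient x z) = \<mu>\<^sub>1 x \<otimes>\<^bsub>G\<^esub> \<mu>\<^sub>2 z"
    using assms unfolding lq.group_isotope_iff by blast
  interpret G: group G by fact
  have I: "bij_betw (\<lambda>x. inv\<^bsub>G\<^esub> x) Q Q"
    using G.bij_betw_inv by (simp add: G)
  have "bij_betw (\<lambda>x. inv\<^bsub>G\<^esub> \<mu>\<^sub>1 x) Q Q"
    using bij_betw_trans[OF \<mu>(1) I] by (simp add: comp_def)
  moreover have "\<mu>\<^sub>2 (x \<cdot> y) = inv\<^bsub>G\<^esub> \<mu>\<^sub>1 x \<otimes>\<^bsub>G\<^esub> \<mu>\<^sub>3 y" if "x \<in> Q" "y \<in> Q" for x y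
  proof -
    have "left_quotient x (x \<cdot> y) = y"
      using that closed by (simp add: left_quotient_eq_iff)
    then have "\<mu>\<^sub>3 y = \<mu>\<^sub>1 x \<otimes>\<^bsub>G\<^esub> \<mu>\<^sub>2 (x \<cdot> y)"
      using eq[of x "x \<cdot> y"] that closed by simp
    moreover have "\<mu>\<^sub>1 x \<in> carrier G" "\<mu>\<^sub>2 (x \<cdot> y) \<in> carrier G"
      using that closed bij_betwE[OF \<mu>(1)] bij_betwE[OF \<mu>(2)] by (simp_all add: G)
    ultimately show ?thesis
      by (simp flip: G.m_assoc)
  qed
  ultimately show ?thesis
    unfolding group_isotope_iff using \<open>group G\<close> G \<mu> by blast
qed

end

section \<open>A-nuclear quasigroups\<close>

theorem theorem2p53:
  fixes Q :: "'a set" and f :: "'a \<Rightarrow> 'a \<Rightarrow> 'a"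
  assumes "quasigroup Q f"
  shows "A_nuclear Q f \<longleftrightarrow> group_isotope Q f"
proof -
  interpret quasigroup Q f by fact
  show ?thesis
  proof
    assume "A_nuclear Q f"
    then show "group_isotope Q f"
      unfolding A_nuclear_def right_components_opposite middle_components_left_quotient
      using group_isotope_if_left
        group_isotope_if_opposite[OF quasigroup.group_isotope_if_left[OF quasigroup_opposite]]
        group_isotope_if_left_quotient[OF
          quasigroup.group_isotope_if_left[OF quasigroup_left_quotient]]
      by blast
  next
    assume "group_isotope Q f"
    then show "A_nuclear Q f"
      unfolding A_nuclear_def using left_first_transitive_if_group_isotope by blast
  qed
qed

end
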